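(* Let $r\ge2$ be an integer. If $r$ is even, then $$\|p_n\|_{r} \sim \frac{2}{(2\pi)^{n}} \left(\frac{1\cdot 3\cdot 5\cdots (r-1)}{2\cdot 4\cdot 6\cdots r}\right)^{1/r} \quad\text{as } n\to\infty.$$ If $r\ge3$ is odd, then $$\|p_n\|_{r} \sim \frac{2}{(2\pi)^{n}} \left(\frac{2\cdot 4\cdot 6\cdots (r-1)}{1\cdot 3\cdot 5\cdots r}\cdot\frac{2}{\pi}\right)^{1/r} \quad\text{as } n\to\infty.$$
   Context: The Bernoulli polynomials $B_n(x)$ are defined by $B_0(x)=1$ and, for $n\ge1$, $\frac{d}{dx}B_n(x)=nB_{n-1}(x)$ together with $\int_0^1 B_n(x)\,dx=0$. Put $p_n(x)=B_n(x)/n!$. For a polynomial $p$ and $1\le r<\infty$, $\|p\|_r=\left(\int_0^1|p(x)|^r\,dx\right)^{1/r}$. Here $u_n\sim v_n$ means $u_n/v_n\to1$ as $n\to\infty$. *)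

theory Defs
  imports "HOL-Analysis.Analysis" "HOL-Computational_Algebra.Polynomial"
    "HOL-Library.Landau_Symbols"
begin

primrec bernoulli_poly :: "nat \<Rightarrow> real poly" where
  "bernoulli_poly 0 = 1"
| "bernoulli_poly (Suc n) =
     (THE p. pderiv p = smult (real (Suc n)) (bernoulli_poly n) \<and> integral {0..1} (poly p) = 0)"

text \<open>The recursion step determines a polynomial: an antiderivative is unique up to an additive
  constant, which the integral condition fixes.\<close>

lemma ex1_antiderivative_poly_mean_zero:
  fixes q :: "real poly"
  shows "\<exists>!p. pderiv p = q \<and> integral {0..1} (poly p) = 0"
proof -
  define P where "P = (\<Sum>i\<le>degree q. monom (coeff q i / real (Suc i)) (Suc i))"
  have "coeff P (Suc i) = coeff q i / real (Suc i)" for i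
    unfolding P_def by (auto simp: coeff_sum coeff_eq_0 simp del: of_nat_Suc)
  then have P: "pderiv P = q"
    by (intro poly_eqI) (simp add: coeff_pderiv del: of_nat_Suc)
  have int: "poly p integrable_on {0..1}" for p :: "real poly"
    by (intro integrable_continuous_real continuous_intros)
  have shift: "integral {0..1} (poly (p + [:c:])) = integral {0..1} (poly p) + c"
    for p :: "real poly" and c
  proof -
    have "poly (p + [:c:]) = (\<lambda>x. poly p x + c)"
      by (simp add: fun_eq_iff)
    then show ?thesis
      using integral_add[OF int[of p], of "\<lambda>x. c"] by (simp add: integrable_const_ivl)
  qed
  show ?thesis
  proof (rule ex1I[of _ "P + [:- integral {0..1} (poly P):]"])
    show "pderiv (P + [:- integral {0..1} (poly P):]) = q \<and>
        integral {0..1} (poly (P + [:- integral {0..1} (poly P):])) = 0"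
      unfolding shift by (simp add: pderiv_add pderiv_pCons P)
  next
    fix p assume p: "pderiv p = q \<and> integral {0..1} (poly p) = 0"
    then have "pderiv (p - P) = 0"
      by (simp add: pderiv_diff P)
    then obtain c where "p - P = [:c:]"
      by (metis pderiv_eq_0_iff degree_eq_zeroE)
    then have pc: "p = P + [:c:]"
      by (simp add: algebra_simps)
    with p have "integral {0..1} (poly P) + c = 0"
      using shift[of P c] by simp
    then show "p = P + [:- integral {0..1} (poly P):]"
      using pc by (simp add: add_eq_0_iff)
  qed
qed

lemma bernoulli_poly_Suc:
  "pderiv (bernoulli_poly (Suc n)) = smult (real (Suc n)) (bernoulli_poly n)"
  "integral {0..1} (poly (bernoulli_poly (Suc n))) = 0"
  using theI'[OF ex1_antiderivative_poly_mean_zero[of "smult (real (Suc n)) (bernoulli_poly n)"]]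
  by simp_all

declare bernoulli_poly.simps(2) [simp del]

definition scaled_bernoulli_poly :: "nat \<Rightarrow> real poly" where
  "scaled_bernoulli_poly n = smult (1 / fact n) (bernoulli_poly n)"

definition poly_Lnorm :: "real \<Rightarrow> real poly \<Rightarrow> real" where
  "poly_Lnorm r p = (integral {0..1} (\<lambda>x. \<bar>poly p x\<bar> powr r)) powr (1 / r)"

end

theory Submission
  imports Defs
begin

text \<open>The functions \<open>- 2 cos (2\<pi>x - n\<pi>/2) / (2\<pi>)\<^sup>n\<close> obey the same recursion as \<open>p\<^sub>n\<close>: each
  is the mean-zero antiderivative of its predecessor. Their difference from \<open>p\<^sub>n\<close> is orthogonal
  to the trigonometric polynomials of degree 1 for \<open>n \<ge> 1\<close>, and on such functions mean-zero
  integration contracts the sup norm by the Bohr--Favard constant \<open>1/8 < 1/(2\<pi>)\<close>. Hence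
  \<open>(2\<pi>)\<^sup>n p\<^sub>n / 2\<close> is uniformly close to a shifted cosine, the mean of whose \<open>r\<close>-th
  absolute power is the Wallis integral.\<close>

section \<open>Kernel estimate and the Bohr-Favard inequality of degree one\<close>

text \<open>Sine is concave on [0, pi/2] and so lies above its chord between the endpoints.\<close>

lemma jordan_sin_ge:
  fixes v :: real
  assumes "0 \<le> v" "v \<le> 1/4"
  shows "4 * v \<le> sin (2 * pi * v)"
proof -
  have cc: "concave_on {0..pi/2} sin"
  proof (rule f''_le0_imp_concave[where f'=cos and f''="\<lambda>x. - sin x"])
    show "- sin x \<le> 0" if "x \<in> {0..pi/2}" for x :: real
      using that sin_ge_zero[of x] by auto
  qed (auto intro!: derivative_eq_intros)
  from concave_onD[OF cc, of "4 * v" 0 "pi/2"] show ?thesis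
    using assms by (simp add: mult.commute mult.left_commute)
qed

text \<open>The sign alternates over the four pieces cut by -1/4, 0 and 1/4. On the inner two
  \<open>jordan_sin_ge\<close> decides it, on the outer two the bound 1 for |sin|. In the total the
  terms in 1/pi cancel.\<close>

lemma has_integral_abs_sawtooth_minus_sin:
  "((\<lambda>v::real. \<bar>v - sin (2 * pi * v) / 4\<bar>) has_integral 1/8) {-1/2..1/2}"
proof -
  let ?h = "\<lambda>v::real. \<bar>v - sin (2 * pi * v) / 4\<bar>"
  define P where "P v = v^2/2 + cos (2*pi * v) / (8*pi)" for v :: real
  have D: "(P has_vector_derivative (v - sin (2 * pi * v) / 4)) (at v within A)" for v A
    unfolding P_def has_real_derivative_iff_has_vector_derivative[symmetric]
    by (auto intro!: derivative_eq_intros simp: field_simps)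
  have D': "((\<lambda>v. - P v) has_vector_derivative - (v - sin (2 * pi * v) / 4)) (at v within A)" for v A
    by (intro has_vector_derivative_minus D)
  have v1: "P (1/2) = 1/8 - 1/(8*pi)" "P (-(1/2)) = 1/8 - 1/(8*pi)" "P 0 = 1/(8*pi)"
    "P (1/4) = 1/32" "P (-(1/4)) = 1/32"
    by (auto simp: P_def power2_eq_square)
  have a1: "(?h has_integral - P (-1/4) - - P (-1/2)) {-1/2..-1/4}"
  proof (rule has_integral_eq[OF _ fundamental_theorem_of_calculus[OF _ D']])
    fix v :: real assume "v \<in> {-1/2..-1/4}"
    then show "- (v - sin (2 * pi * v) / 4) = ?h v" using sin_ge_minus_one[of "2*pi * v"]
      unfolding atLeastAtMost_iff by linarith
  qed simp
  have a2: "(?h has_integral P 0 - P (-1/4)) {-1/4..0}"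
  proof (rule has_integral_eq[OF _ fundamental_theorem_of_calculus[OF _ D]])
    fix v :: real assume "v \<in> {-1/4..0}"
    then show "v - sin (2 * pi * v) / 4 = ?h v" using jordan_sin_ge[of "-v"] by auto
  qed simp
  have a3: "(?h has_integral - P (1/4) - - P 0) {0..1/4}"
  proof (rule has_integral_eq[OF _ fundamental_theorem_of_calculus[OF _ D']])
    fix v :: real assume "v \<in> {0..1/4}"
    then show "- (v - sin (2 * pi * v) / 4) = ?h v" using jordan_sin_ge[of "v"] by auto
  qed simp
  have a4: "(?h has_integral P (1/2) - P (1/4)) {1/4..1/2}"
  proof (rule has_integral_eq[OF _ fundamental_theorem_of_calculus[OF _ D]])
    fix v :: real assume "v \<in> {1/4..1/2}"
    then show "v - sin (2 * pi * v) / 4 = ?h v" using sin_le_one[of "2*pi * v"]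
      unfolding atLeastAtMost_iff by linarith
  qed simp
  have "(?h has_integral (- P (-1/4) - - P (-1/2)) + (P 0 - P (-1/4))) {-1/2..0}"
    by (rule has_integral_combine[OF _ _ a1 a2]) auto
  from has_integral_combine[OF _ _ this a3]
  have "(?h has_integral (- P (-1/4) - - P (-1/2)) + (P 0 - P (-1/4)) + (- P (1/4) - - P 0)) {-1/2..1/4}"
    by auto
  from has_integral_combine[OF _ _ this a4]
  show ?thesis using v1 by simp
qed

text \<open>Mean-zero integration is convolution with a sawtooth. Subtracting the sine that interpolates
  the sawtooth at \<open>0\<close> and \<open>\<plusminus>1/4\<close> is harmless by orthogonality and lowers the
  \<open>L\<^sup>1\<close> norm of the kernel from \<open>1/4\<close> to \<open>1/8\<close>, which is less than \<open>1/(2\<pi>)\<close>.\<close>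

lemma bohr_favard_degree_one:
  fixes f g :: "real \<Rightarrow> real"
  assumes deriv: "\<And>y. y \<in> {0..1} \<Longrightarrow> (f has_real_derivative g y) (at y within {0..1})"
    and f0: "(f has_integral 0) {0..1}"
    and g0: "(g has_integral 0) {0..1}"
    and gs: "((\<lambda>y. g y * sin (2*pi*y)) has_integral 0) {0..1}"
    and gc: "((\<lambda>y. g y * cos (2*pi*y)) has_integral 0) {0..1}"
    and M: "\<And>y. y \<in> {0..1} \<Longrightarrow> \<bar>g y\<bar> \<le> M"
    and x: "x \<in> {0..1}"
  shows "\<bar>f x\<bar> \<le> M / 8"
proof -
  \<comment> \<open>The branches y and y - 1 vanish at 0 and at 1 respectively, so integration by
    parts on the two sides of \<open>x\<close> leaves only \<open>f x\<close>, with weights x and 1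
    - x.\<close>
  define k where "k y = (if y \<le> x then y else y - 1)" for y :: real
  \<comment> \<open>\<open>H\<close> differs from \<open>k\<close> by a combination of 1, sin(2 pi
    y) and cos(2 pi y), all orthogonal to \<open>g\<close>, so it represents \<open>f x\<close> as
    well.\<close>
  define H where "H y = k y - x + 1/2 - sin (2*pi*(y - x + 1/2)) / 4" for y
  have dA: "((\<lambda>y. (y - c) * f y) has_vector_derivative (y - c) * g y + f y) (at y within A)"
    if "y \<in> {0..1}" "A \<subseteq> {0..1}" for y c A
    unfolding has_real_derivative_iff_has_vector_derivative[symmetric]
    by (rule derivative_eq_intros DERIV_subset[OF deriv] that refl)+ simp
  have i1: "((\<lambda>y. k y * g y + f y) has_integral (x * f x)) {0..x}"
  proof -
    have "((\<lambda>y. (y - 0) * g y + f y) has_integral (x - 0) * f x - (0 - 0) * f 0) {0..x}"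
      by (rule fundamental_theorem_of_calculus[OF _ dA]) (use x in auto)
    then show ?thesis
      by (simp, elim has_integral_eq[rotated]) (simp add: k_def)
  qed
  have i2: "((\<lambda>y. k y * g y + f y) has_integral ((1 - x) * f x)) {x..1}"
  proof -
    have "((\<lambda>y. (y - 1) * g y + f y) has_integral (1 - 1) * f 1 - (x - 1) * f x) {x..1}"
      by (rule fundamental_theorem_of_calculus[OF _ dA]) (use x in auto)
    then have "((\<lambda>y. k y * g y + f y) has_integral (1 - 1) * f 1 - (x - 1) * f x) {x..1}"
      by (rule has_integral_spike_finite[of "{x}", rotated 2]) (auto simp: k_def)
    then show ?thesis by (simp add: algebra_simps)
  qed
  have "((\<lambda>y. k y * g y + f y) has_integral (x * f x + (1 - x) * f x)) {0..1}"
    by (rule has_integral_combine[OF _ _ i1 i2]) (use x in auto)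
  from has_integral_diff[OF this f0]
  have kg: "((\<lambda>y. k y * g y) has_integral f x) {0..1}" by (simp add: algebra_simps)
  have "((\<lambda>y. k y * g y - (x - 1/2) * g y
       + (cos (2*pi*x) / 4) * (g y * sin (2*pi*y)) - (sin (2*pi*x) / 4) * (g y * cos (2*pi*y)))
       has_integral f x - (x - 1/2) * 0 + (cos (2*pi*x) / 4) * 0 - (sin (2*pi*x) / 4) * 0) {0..1}"
    by (intro has_integral_add has_integral_diff has_integral_mult_right kg g0 gs gc)
  moreover
  have sinH: "sin (2*pi*(y - x + 1/2)) = - (sin (2*pi*y) * cos (2*pi*x) - cos (2*pi*y) * sin (2*pi*x))" for y
  proof -
    have "sin (2*pi*(y - x + 1/2)) = sin (2*pi*y - 2*pi*x + pi)" by (simp add: algebra_simps)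
    then show ?thesis by (simp add: sin_diff)
  qed
  have Hexp: "H y * g y = k y * g y - (x - 1/2) * g y
       + (cos (2*pi*x) / 4) * (g y * sin (2*pi*y)) - (sin (2*pi*x) / 4) * (g y * cos (2*pi*y))" for y
    unfolding H_def sinH by (simp add: algebra_simps add_divide_distrib diff_divide_distrib)
  ultimately have Hg: "((\<lambda>y. H y * g y) has_integral f x) {0..1}"
    unfolding Hexp by simp
  let ?h = "\<lambda>v::real. \<bar>v - sin (2 * pi * v) / 4\<bar>"
  \<comment> \<open>An antiderivative of the absolute kernel replaces substitution in the shifted
    integrals. The arguments that occur lie in [-1/2, 1/2]; the larger interval makes them interior
    points.\<close>
  have "continuous_on {-2..2} ?h" by (intro continuous_intros) auto
  then obtain \<Phi> where \<Phi>: "\<And>v. v \<in> {-2..2} \<Longrightarrow> (\<Phi> has_vector_derivative ?h v) (at v within {-2..2})"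
    by (rule antiderivative_continuous) blast
  have \<Phi>': "(\<Phi> has_real_derivative ?h v) (at v)" if "-2 < v" "v < 2" for v
    using \<Phi>[of v] that at_within_interior[of v "{-2..2}"]
    by (simp add: has_real_derivative_iff_has_vector_derivative)
  have "(?h has_integral \<Phi> (1/2) - \<Phi> (-1/2)) {-1/2..1/2}"
    by (rule fundamental_theorem_of_calculus)
       (auto intro!: has_vector_derivative_within_subset[OF \<Phi>])
  from has_integral_unique[OF this has_integral_abs_sawtooth_minus_sin]
  have \<Phi>8: "\<Phi> (1/2) - \<Phi> (-1/2) = 1/8" .
  have \<Phi>d: "((\<lambda>y. \<Phi> (y - c)) has_vector_derivative ?h (y - c)) (at y within A)"
    if "-2 < y - c" "y - c < 2" for y c A
  proof -
    have "((\<lambda>y. \<Phi> (y - c)) has_real_derivative ?h (y - c) * 1) (at y within A)"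
      by (rule DERIV_chain2[OF \<Phi>'])
         (use that in \<open>auto intro!: derivative_eq_intros\<close>)
    then show ?thesis by (simp add: has_real_derivative_iff_has_vector_derivative)
  qed
  have j1: "((\<lambda>y. \<bar>H y\<bar>) has_integral \<Phi> (1/2) - \<Phi> (1/2 - x)) {0..x}"
  proof -
    have "((\<lambda>y. ?h (y - (x - 1/2))) has_integral \<Phi> (x - (x - 1/2)) - \<Phi> (0 - (x - 1/2))) {0..x}"
      by (rule fundamental_theorem_of_calculus[OF _ \<Phi>d]) (use x in auto)
    then have "((\<lambda>y. \<bar>H y\<bar>) has_integral \<Phi> (x - (x - 1/2)) - \<Phi> (0 - (x - 1/2))) {0..x}"
      by (rule has_integral_eq[rotated]) (simp add: H_def k_def algebra_simps)
    then show ?thesis by simp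
  qed
  have j2: "((\<lambda>y. \<bar>H y\<bar>) has_integral \<Phi> (1/2 - x) - \<Phi> (-1/2)) {x..1}"
  proof -
    have "((\<lambda>y. ?h (y - (x + 1/2))) has_integral \<Phi> (1 - (x + 1/2)) - \<Phi> (x - (x + 1/2))) {x..1}"
      by (rule fundamental_theorem_of_calculus[OF _ \<Phi>d]) (use x in auto)
    \<comment> \<open>The point \<open>x\<close> is left out because \<open>k\<close> takes its left
      branch there.\<close>
    moreover have "\<bar>H y\<bar> = ?h (y - (x + 1/2))" if "y \<in> {x..1} - {x}" for y
    proof -
      have "sin (2*pi*(y - (x + 1/2))) = sin (2*pi*(y - x + 1/2) - 2*pi)"
        by (simp add: algebra_simps)
      then have "sin (2*pi*(y - (x + 1/2))) = sin (2*pi*(y - x + 1/2))"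
        by (simp only: sin_minus_pi sin_diff) simp
      then show ?thesis using that by (simp add: H_def k_def)
    qed
    ultimately have "((\<lambda>y. \<bar>H y\<bar>) has_integral \<Phi> (1 - (x + 1/2)) - \<Phi> (x - (x + 1/2))) {x..1}"
      by (intro has_integral_spike_finite[of "{x}" "{x..1}" "\<lambda>y. \<bar>H y\<bar>" "\<lambda>y. ?h (y - (x + 1/2))"]) auto
    then show ?thesis by simp
  qed
  \<comment> \<open>The two pieces together sweep one full period of the kernel, so the
    \<open>L^1\<close> norm does not depend on \<open>x\<close>.\<close>
  have "((\<lambda>y. \<bar>H y\<bar>) has_integral (\<Phi> (1/2) - \<Phi> (1/2 - x)) + (\<Phi> (1/2 - x) - \<Phi> (-1/2))) {0..1}"
    by (rule has_integral_combine[OF _ _ j1 j2]) (use x in auto)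
  moreover have "(\<Phi> (1/2) - \<Phi> (1/2 - x)) + (\<Phi> (1/2 - x) - \<Phi> (-1/2)) = 1/8"
    using \<Phi>8 by linarith
  ultimately have "((\<lambda>y. \<bar>H y\<bar>) has_integral 1/8) {0..1}" by (simp only:)
  then have HM: "((\<lambda>y. M * \<bar>H y\<bar>) has_integral M * (1/8)) {0..1}" by (rule has_integral_mult_right)
  have le: "\<bar>H y * g y\<bar> \<le> M * \<bar>H y\<bar>" if "y \<in> {0..1}" for y
    using mult_left_mono[OF M[OF that], of "\<bar>H y\<bar>"] by (simp add: abs_mult mult.commute)
  have "f x \<le> M * (1/8)"
    by (rule has_integral_le[OF Hg HM]) (use le in force)
  moreover have "- f x \<le> M * (1/8)"
    by (rule has_integral_le[OF has_integral_neg[OF Hg] HM]) (use le in force)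
  ultimately show ?thesis by simp
qed

section \<open>Scaled Bernoulli polynomials and the remainder beyond the leading cosine\<close>

lemma scaled_bernoulli_poly_0: "scaled_bernoulli_poly 0 = 1"
  by (simp add: scaled_bernoulli_poly_def)

lemma pderiv_scaled_bernoulli_poly:
  "pderiv (scaled_bernoulli_poly (Suc n)) = scaled_bernoulli_poly n"
  by (simp add: scaled_bernoulli_poly_def pderiv_smult bernoulli_poly_Suc field_simps
      del: of_nat_Suc)

lemma has_integral_scaled_bernoulli_poly:
  "(poly (scaled_bernoulli_poly (Suc n)) has_integral 0) {0..1}"
proof -
  have "poly (bernoulli_poly (Suc n)) integrable_on {0..1}"
    by (intro integrable_continuous_real continuous_intros)
  then have "(poly (bernoulli_poly (Suc n)) has_integral 0) {0..1}"
    using bernoulli_poly_Suc(2)[of n] by (simp add: has_integral_integral)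
  from has_integral_mult_right[OF this, of "1 / fact (Suc n)"] show ?thesis
    unfolding scaled_bernoulli_poly_def by (simp add: poly_smult [abs_def] del: fact_Suc)
qed

text \<open>For n >= 1 the degree-one Fourier part of \<open>scaled_bernoulli_poly n\<close> is -2
  cos(2 pi x - n pi/2) / (2 pi)^n, hence the plus sign. The rescaling gives the cosine the same
  amplitude for every n.\<close>

definition bernoulli_remainder :: "nat \<Rightarrow> real \<Rightarrow> real" where
  "bernoulli_remainder n x =
     (2*pi)^n * poly (scaled_bernoulli_poly n) x + 2 * cos (2*pi*x - real n * pi / 2)"

lemma cos_sub_Suc_quarter: "cos (t - real (Suc n) * pi / 2) = sin (t - real n * pi / 2)"
proof -
  have "t - real (Suc n) * pi / 2 = (t - real n * pi / 2) - pi / 2"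
    by (simp add: field_simps)
  then show ?thesis by (simp only: cos_diff) simp
qed

lemma sin_sub_Suc_quarter: "sin (t - real (Suc n) * pi / 2) = - cos (t - real n * pi / 2)"
proof -
  have "t - real (Suc n) * pi / 2 = (t - real n * pi / 2) - pi / 2"
    by (simp add: field_simps)
  then show ?thesis by (simp only: sin_diff) simp
qed

lemma bernoulli_remainder_deriv:
  "(bernoulli_remainder (Suc n) has_real_derivative 2*pi * bernoulli_remainder n x) (at x within A)"
  unfolding bernoulli_remainder_def
  by (rule derivative_eq_intros refl | simp only: pderiv_scaled_bernoulli_poly sin_sub_Suc_quarter)+
     (simp add: algebra_simps)

lemma continuous_on_bernoulli_remainder: "continuous_on A (bernoulli_remainder n)"
  unfolding bernoulli_remainder_def by (intro continuous_intros)

lemma bernoulli_remainder_mean_zero: "(bernoulli_remainder (Suc n) has_integral 0) {0..1}"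
proof -
  have "((\<lambda>x. 2 * cos (2*pi*x - real (Suc n) * pi / 2)) has_integral
      sin (2*pi*1 - real (Suc n) * pi / 2) / pi - sin (2*pi*0 - real (Suc n) * pi / 2) / pi) {0..1}"
    by (rule fundamental_theorem_of_calculus)
       (auto intro!: derivative_eq_intros
          simp: has_real_derivative_iff_has_vector_derivative[symmetric])
  moreover have "sin (2*pi*1 - real (Suc n) * pi / 2) = sin (2*pi*0 - real (Suc n) * pi / 2)"
    by (simp add: sin_diff)
  ultimately have "((\<lambda>x. 2 * cos (2*pi*x - real (Suc n) * pi / 2)) has_integral 0) {0..1}"
    by simp
  from has_integral_add[OF has_integral_mult_right[OF has_integral_scaled_bernoulli_poly[of n],
      of "(2*pi)^Suc n"] this]
  show ?thesis unfolding bernoulli_remainder_def [abs_def] by (simp only: mult_zero_right add_0)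
qed

text \<open>Both claims are integrations by parts over a period. Against sine the boundary terms
  vanish; against cosine they leave the jump of \<open>q (Suc n)\<close> from 0 to 1, which the mean
  of \<open>q n\<close> determines.\<close>

lemma bernoulli_remainder_orthogonal_step:
  fixes n :: nat
  defines "q \<equiv> bernoulli_remainder"
  assumes S: "((\<lambda>y. q n y * sin (2*pi*y)) has_integral s) {0..1}"
    and C: "((\<lambda>y. q n y * cos (2*pi*y)) has_integral c) {0..1}"
    and I: "(q n has_integral i) {0..1}"
  shows "((\<lambda>y. q (Suc n) y * cos (2*pi*y)) has_integral - s) {0..1}"
    and "((\<lambda>y. q (Suc n) y * sin (2*pi*y)) has_integral c - i) {0..1}"
proof -
  note d = bernoulli_remainder_deriv[of n, folded q_def]
  have "((\<lambda>y. q (Suc n) y * cos (2*pi*y) + q n y * sin (2*pi*y)) has_integral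
     q (Suc n) 1 * sin (2*pi*1) / (2*pi) - q (Suc n) 0 * sin (2*pi*0) / (2*pi)) {0..1}"
    by (rule fundamental_theorem_of_calculus)
       (auto intro!: derivative_eq_intros d
          simp: has_real_derivative_iff_has_vector_derivative[symmetric] field_simps)
  from has_integral_diff[OF this S]
  show "((\<lambda>y. q (Suc n) y * cos (2*pi*y)) has_integral - s) {0..1}" by simp
  have "((\<lambda>y. 2 * pi * q n y) has_integral q (Suc n) 1 - q (Suc n) 0) {0..1}"
    by (rule fundamental_theorem_of_calculus)
       (auto intro!: d simp: has_real_derivative_iff_has_vector_derivative[symmetric])
  from has_integral_unique[OF this has_integral_mult_right[OF I, of "2*pi"]]
  have jump: "q (Suc n) 1 - q (Suc n) 0 = 2 * pi * i" .
  have "((\<lambda>y. q n y * cos (2*pi*y) - q (Suc n) y * sin (2*pi*y)) has_integral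
     q (Suc n) 1 * cos (2*pi*1) / (2*pi) - q (Suc n) 0 * cos (2*pi*0) / (2*pi)) {0..1}"
    by (rule fundamental_theorem_of_calculus)
       (auto intro!: derivative_eq_intros d
          simp: has_real_derivative_iff_has_vector_derivative[symmetric] field_simps)
  moreover have "q (Suc n) 1 * cos (2*pi*1) / (2*pi) - q (Suc n) 0 * cos (2*pi*0) / (2*pi) = i"
    using jump by (simp add: field_simps)
  ultimately have "((\<lambda>y. q n y * cos (2*pi*y) - q (Suc n) y * sin (2*pi*y)) has_integral i) {0..1}"
    by simp
  from has_integral_diff[OF C this]
  show "((\<lambda>y. q (Suc n) y * sin (2*pi*y)) has_integral c - i) {0..1}" by simp
qed

text \<open>Orthogonality fails at index 0, but the cosine moment and the mean are both 1 and enter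
  the next sine moment only through \<open>c - i\<close>. Hence it holds from index 1 on.\<close>

lemma bernoulli_remainder_0_integrals:
  "((\<lambda>y. bernoulli_remainder 0 y * sin (2*pi*y)) has_integral 0) {0..1}"
  "((\<lambda>y. bernoulli_remainder 0 y * cos (2*pi*y)) has_integral 1) {0..1}"
  "(bernoulli_remainder 0 has_integral 1) {0..1}"
proof -
  have q0: "bernoulli_remainder 0 = (\<lambda>y. 1 + 2 * cos (2*pi*y))"
    by (simp add: bernoulli_remainder_def scaled_bernoulli_poly_0 fun_eq_iff)
  define F where "F y = - cos (2*pi*y) / (2*pi) + sin (2*pi*y) * sin (2*pi*y) / (2*pi)" for y :: real
  have "((\<lambda>y. bernoulli_remainder 0 y * sin (2*pi*y)) has_integral F 1 - F 0) {0..1}"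
    unfolding q0 F_def by (rule fundamental_theorem_of_calculus)
       (auto intro!: derivative_eq_intros
          simp: has_real_derivative_iff_has_vector_derivative[symmetric] field_simps)
  then show "((\<lambda>y. bernoulli_remainder 0 y * sin (2*pi*y)) has_integral 0) {0..1}"
    by (simp add: F_def)
  define G where "G y = y + sin (2*pi*y) / (2*pi) + sin (2*pi*y) * cos (2*pi*y) / (2*pi)" for y :: real
  have "((\<lambda>y. bernoulli_remainder 0 y * cos (2*pi*y)) has_integral G 1 - G 0) {0..1}"
  proof (rule fundamental_theorem_of_calculus)
    fix y :: real
    have "(1 + 2 * cos (2*pi*y)) * cos (2*pi*y) =
        1 + cos (2*pi*y) + (cos (2*pi*y) * cos (2*pi*y) - sin (2*pi*y) * sin (2*pi*y))"
      using sin_cos_squared_add3[of "2*pi*y"] by (simp add: algebra_simps)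
    moreover have "(G has_real_derivative 1 + cos (2*pi*y)
        + (cos (2*pi*y) * cos (2*pi*y) - sin (2*pi*y) * sin (2*pi*y))) (at y within {0..1})"
      unfolding G_def by (auto intro!: derivative_eq_intros simp: field_simps)
    ultimately show "(G has_vector_derivative bernoulli_remainder 0 y * cos (2*pi*y)) (at y within {0..1})"
      unfolding q0 has_real_derivative_iff_has_vector_derivative[symmetric] by simp
  qed simp
  then show "((\<lambda>y. bernoulli_remainder 0 y * cos (2*pi*y)) has_integral 1) {0..1}"
    by (simp add: G_def)
  define K where "K y = y + sin (2*pi*y) / pi" for y :: real
  have "(bernoulli_remainder 0 has_integral K 1 - K 0) {0..1}"
    unfolding q0 K_def by (rule fundamental_theorem_of_calculus)
       (auto intro!: derivative_eq_intros
          simp: has_real_derivative_iff_has_vector_derivative[symmetric] field_simps)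
  then show "(bernoulli_remainder 0 has_integral 1) {0..1}"
    by (simp add: K_def)
qed

lemma bernoulli_remainder_orthogonal:
  "((\<lambda>y. bernoulli_remainder (Suc n) y * cos (2*pi*y)) has_integral 0) {0..1} \<and>
   ((\<lambda>y. bernoulli_remainder (Suc n) y * sin (2*pi*y)) has_integral 0) {0..1}"
proof (induction n)
  case 0
  show ?case
    using bernoulli_remainder_orthogonal_step[OF bernoulli_remainder_0_integrals] by simp
next
  case (Suc n)
  from bernoulli_remainder_orthogonal_step[OF conjunct2[OF Suc] conjunct1[OF Suc]
      bernoulli_remainder_mean_zero]
  show ?case by simp
qed

text \<open>Passing to the next index integrates 2 pi times the current remainder, and
  \<open>bohr_favard_degree_one\<close> contributes 1/8, so the ratio is 2 pi / 8 = pi/4. The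
  induction starts at index 1, where orthogonality first holds.\<close>

lemma bernoulli_remainder_geometric_bound:
  obtains C where "\<And>n x. x \<in> {0..1} \<Longrightarrow> \<bar>bernoulli_remainder (Suc n) x\<bar> \<le> C * (pi/4)^n"
proof -
  have "compact (bernoulli_remainder 1 ` {0..1})"
    by (intro compact_continuous_image continuous_on_bernoulli_remainder) simp
  then have "\<exists>C. \<forall>x\<in>{0..1}. \<bar>bernoulli_remainder 1 x\<bar> \<le> C"
    by (auto dest!: compact_imp_bounded simp: bounded_iff)
  then obtain C where C: "\<And>x. x \<in> {0..1} \<Longrightarrow> \<bar>bernoulli_remainder 1 x\<bar> \<le> C"
    by blast
  have "\<bar>bernoulli_remainder (Suc n) x\<bar> \<le> C * (pi/4)^n" if "x \<in> {0..1}" for n x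
    using that
  proof (induction n arbitrary: x)
    case 0
    then show ?case using C by simp
  next
    case (Suc n)
    have "\<bar>bernoulli_remainder (Suc (Suc n)) x\<bar> \<le> (2*pi * (C * (pi/4)^n)) / 8"
    proof (rule bohr_favard_degree_one[OF bernoulli_remainder_deriv bernoulli_remainder_mean_zero
          _ _ _ _ Suc.prems])
      note o = bernoulli_remainder_orthogonal[of n]
      show "((\<lambda>y. 2 * pi * bernoulli_remainder (Suc n) y) has_integral 0) {0..1}"
        using has_integral_mult_right[OF bernoulli_remainder_mean_zero, of "2*pi"] by simp
      show "((\<lambda>y. 2 * pi * bernoulli_remainder (Suc n) y * sin (2*pi*y)) has_integral 0) {0..1}"
        using has_integral_mult_right[OF conjunct2[OF o], of "2*pi"] by (simp add: mult.assoc)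
      show "((\<lambda>y. 2 * pi * bernoulli_remainder (Suc n) y * cos (2*pi*y)) has_integral 0) {0..1}"
        using has_integral_mult_right[OF conjunct1[OF o], of "2*pi"] by (simp add: mult.assoc)
      show "\<bar>2 * pi * bernoulli_remainder (Suc n) y\<bar> \<le> 2 * pi * (C * (pi/4)^n)" if "y \<in> {0..1}" for y
        using Suc.IH[OF that] by (simp add: abs_mult)
    qed
    then show ?case by (simp add: field_simps)
  qed
  then show ?thesis by (rule that)
qed

section \<open>Mean absolute powers of a shifted cosine\<close>

text \<open>The extra factor x makes the function differentiable at 0 for every k, so powers of
  |cos| can be integrated by parts without splitting at the zeros of cosine.\<close>

lemma DERIV_mult_abs_power:
  fixes x :: real
  shows "((\<lambda>x. x * \<bar>x\<bar>^k) has_real_derivative (real k + 1) * \<bar>x\<bar>^k) (at x)"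
proof (cases "x = 0")
  case True
  show ?thesis
  proof (cases k)
    case (Suc m)
    \<comment> \<open>Away from h = 0 the difference quotient at 0 equals |h|^k.\<close>
    have "((\<lambda>h::real. \<bar>h\<bar>^k) \<longlongrightarrow> \<bar>0\<bar>^k) (at 0)"
      by (intro tendsto_intros)
    then have "((\<lambda>h::real. ((0 + h) * \<bar>0 + h\<bar>^k - 0 * \<bar>0\<bar>^k) / h) \<longlongrightarrow> \<bar>0\<bar>^k) (at 0)"
      by (rule Lim_transform_eventually)
         (auto simp: eventually_at_filter)
    then show ?thesis by (simp add: DERIV_def True Suc)
  qed (use True in \<open>auto intro!: derivative_eq_intros\<close>)
next
  case False
  \<comment> \<open>On the half-line containing \<open>x\<close> the absolute value is
    multiplication by the constant \<open>e\<close>.\<close>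
  define e where "e = sgn x"
  have e: "\<bar>x\<bar> = e * x" by (simp add: e_def abs_sgn mult.commute)
  have "((\<lambda>y. y * (e * y)^k) has_real_derivative (real k + 1) * \<bar>x\<bar>^k) (at x)"
  proof (cases k)
    case (Suc m)
    have "((\<lambda>y. y * (e * y)^k) has_real_derivative
        1 * (e * x)^k + real k * (e * x)^(k - 1) * e * x) (at x)"
      by (auto intro!: derivative_eq_intros)
    also have "1 * (e * x)^k + real k * (e * x)^(k - 1) * e * x = (real k + 1) * (e * x)^k"
      by (simp add: Suc algebra_simps)
    finally show ?thesis by (simp add: e)
  qed (auto intro!: derivative_eq_intros)
  then show ?thesis
  proof (rule has_field_derivative_transform_within_open)
    show "open {y. 0 < e * y}" by (intro open_Collect_less continuous_intros)
    show "x \<in> {y. 0 < e * y}" using False by (simp add: e[symmetric])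
    show "y * (e * y)^k = y * \<bar>y\<bar>^k" if "y \<in> {y. 0 < e * y}" for y
      using that by (auto simp: e_def sgn_if zero_less_mult_iff split: if_splits)
  qed
qed

text \<open>This is the Wallis reduction: \<open>G\<close> is periodic, and with sin^2 = 1 - cos^2
  its derivative is exactly the difference of the two integrands.\<close>

lemma has_integral_abs_cos_power_step:
  assumes "((\<lambda>x. \<bar>cos (2*pi*x - a)\<bar>^k) has_integral A) {0..1}"
  shows "((\<lambda>x. \<bar>cos (2*pi*x - a)\<bar>^(k+2)) has_integral (real k + 1) / (real k + 2) * A) {0..1}"
proof -
  define c where "c x = cos (2*pi*x - a)" for x
  define s where "s x = sin (2*pi*x - a)" for x
  define G where "G x = (c x * \<bar>c x\<bar>^k) * s x / (2 * pi * (real k + 2))" for x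
  have dc: "(c has_real_derivative - (2*pi) * s x) (at x within S)" for x S
    unfolding c_def s_def by (auto intro!: derivative_eq_intros)
  have ds: "(s has_real_derivative (2*pi) * c x) (at x within S)" for x S
    unfolding c_def s_def by (auto intro!: derivative_eq_intros)
  have dG: "(G has_real_derivative \<bar>c x\<bar>^(k+2) - (real k + 1) / (real k + 2) * \<bar>c x\<bar>^k) (at x within S)" for x S
  proof -
    have d1: "((\<lambda>x. c x * \<bar>c x\<bar>^k) has_real_derivative (real k + 1) * \<bar>c x\<bar>^k * (- (2*pi) * s x)) (at x within S)"
      by (rule DERIV_chain2[OF DERIV_mult_abs_power dc])
    have ss: "s x * s x = 1 - c x * c x"
      using sin_cos_squared_add3[of "2*pi*x - a"] by (simp add: s_def c_def algebra_simps)
    have cc: "\<bar>c x\<bar>^(k+2) = \<bar>c x\<bar>^k * (c x * c x)"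
      by (simp add: power_add power2_eq_square)
    define P where "P = \<bar>c x\<bar>^k"
    have "(G has_real_derivative ((real k + 1) * \<bar>c x\<bar>^k * (- (2*pi) * s x) * s x
        + (2*pi) * c x * (c x * \<bar>c x\<bar>^k)) / (2*pi*(real k + 2))) (at x within S)"
      unfolding G_def by (intro DERIV_cdivide DERIV_mult d1 ds)
    moreover have "((real k + 1) * P * (- (2*pi) * s x) * s x
        + (2*pi) * c x * (c x * P)) / (2*pi*(real k + 2)) = P * (c x * c x) - (real k + 1) / (real k + 2) * P"
    proof -
      have "(real k + 1) * P * (- (2*pi) * s x) * s x + (2*pi) * c x * (c x * P)
        = (2*pi) * (P * (c x * c x) - (real k + 1) * P * (s x * s x))" by (simp add: algebra_simps)
      also have "\<dots> = (2*pi) * ((real k + 2) * (P * (c x * c x)) - (real k + 1) * P)"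
        unfolding ss by (simp add: algebra_simps)
      finally show ?thesis by (simp add: diff_divide_distrib add_pos_nonneg)
    qed
    ultimately show ?thesis unfolding cc P_def by simp
  qed
  have "((\<lambda>x. \<bar>c x\<bar>^(k+2) - (real k + 1) / (real k + 2) * \<bar>c x\<bar>^k) has_integral G 1 - G 0) {0..1}"
    by (rule fundamental_theorem_of_calculus)
       (simp_all only: dG has_real_derivative_iff_has_vector_derivative[symmetric] zero_le_one)
  moreover have "G 1 = G 0" by (simp add: G_def c_def s_def cos_diff sin_diff)
  ultimately have "((\<lambda>x. \<bar>c x\<bar>^(k+2) - (real k + 1) / (real k + 2) * \<bar>c x\<bar>^k) has_integral 0) {0..1}"
    by simp
  from has_integral_add[OF this has_integral_mult_right[OF assms, of "(real k + 1) / (real k + 2)"]]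
  show ?thesis by (simp add: c_def)
qed

text \<open>Each quarter turn exchanges |cos| and |sin|. The parities are proved together because
  each successor case uses the hypothesis of the other, converted by sin^2 + cos^2 = 1.\<close>

lemma abs_cos_sub_quarter_even: "even n \<Longrightarrow> \<bar>cos (t - real n * pi / 2)\<bar> = \<bar>cos t\<bar>"
  and abs_cos_sub_quarter_odd: "odd n \<Longrightarrow> \<bar>cos (t - real n * pi / 2)\<bar> = \<bar>sin t\<bar>"
proof (induction n)
  case (Suc n)
  have "\<bar>cos (t - real (Suc n) * pi / 2)\<bar> = \<bar>sin (t - real n * pi / 2)\<bar>"
    by (simp only: cos_sub_Suc_quarter)
  {
    case 1
    have "\<bar>sin (t - real n * pi / 2)\<bar>\<^sup>2 = \<bar>cos t\<bar>\<^sup>2"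
      using Suc.IH(2) 1 sin_cos_squared_add[of "t - real n * pi / 2"] sin_cos_squared_add[of t]
      by (metis add_diff_cancel_left' add_diff_cancel_right' even_Suc power2_abs)
    with \<open>\<bar>cos (t - real (Suc n) * pi / 2)\<bar> = _\<close> show ?case by (simp only: power2_eq_iff_nonneg abs_ge_zero)
  next
    case 2
    have "\<bar>sin (t - real n * pi / 2)\<bar>\<^sup>2 = \<bar>sin t\<bar>\<^sup>2"
      using Suc.IH(1) 2 sin_cos_squared_add[of "t - real n * pi / 2"] sin_cos_squared_add[of t]
      by (metis add_diff_cancel_left' add_diff_cancel_right' even_Suc power2_abs)
    with \<open>\<bar>cos (t - real (Suc n) * pi / 2)\<bar> = _\<close> show ?case by (simp only: power2_eq_iff_nonneg abs_ge_zero)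
  }
qed simp_all

text \<open>Together with \<open>has_integral_abs_cos\<close> this settles exponent 1 for both
  parities of the phase index.\<close>

lemma has_integral_abs_sin: "((\<lambda>x. \<bar>sin (2*pi*x)\<bar>) has_integral 2/pi) {0..1}"
proof -
  define F where "F x = - cos (2*pi*x) / (2*pi)" for x :: real
  have D: "(F has_vector_derivative sin (2*pi*x)) (at x within A)" for x A
    unfolding F_def has_real_derivative_iff_has_vector_derivative[symmetric]
    by (auto intro!: derivative_eq_intros)
  have a: "((\<lambda>x. \<bar>sin (2*pi*x)\<bar>) has_integral F (1/2) - F 0) {0..1/2}"
  proof (rule has_integral_eq[OF _ fundamental_theorem_of_calculus[OF _ D]])
    fix x :: real assume "x \<in> {0..1/2}"
    then show "sin (2*pi*x) = \<bar>sin (2*pi*x)\<bar>" by (simp add: sin_ge_zero)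
  qed simp
  have b: "((\<lambda>x. \<bar>sin (2*pi*x)\<bar>) has_integral - F 1 - - F (1/2)) {1/2..1}"
  proof (rule has_integral_eq[OF _ fundamental_theorem_of_calculus[OF _ has_vector_derivative_minus[OF D]]])
    fix x :: real assume "x \<in> {1/2..1}"
    then have "sin (2*pi*x - pi) \<ge> 0" by (intro sin_ge_zero) (auto simp: field_simps)
    then show "- sin (2*pi*x) = \<bar>sin (2*pi*x)\<bar>" by simp
  qed simp
  show ?thesis using has_integral_combine[OF _ _ a b] by (simp add: F_def field_simps)
qed

lemma has_integral_abs_cos: "((\<lambda>x. \<bar>cos (2*pi*x)\<bar>) has_integral 2/pi) {0..1}"
proof -
  define F where "F x = sin (2*pi*x) / (2*pi)" for x :: real
  have D: "(F has_vector_derivative cos (2*pi*x)) (at x within A)" for x A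
    unfolding F_def has_real_derivative_iff_has_vector_derivative[symmetric]
    by (auto intro!: derivative_eq_intros)
  have a: "((\<lambda>x. \<bar>cos (2*pi*x)\<bar>) has_integral F (1/4) - F 0) {0..1/4}"
  proof (rule has_integral_eq[OF _ fundamental_theorem_of_calculus[OF _ D]])
    fix x :: real assume x: "x \<in> {0..1/4}"
    then have "0 \<le> cos (2*pi*x)" by (intro cos_ge_zero) (auto intro: order_trans[of _ 0])
    then show "cos (2*pi*x) = \<bar>cos (2*pi*x)\<bar>" by simp
  qed simp
  have b: "((\<lambda>x. \<bar>cos (2*pi*x)\<bar>) has_integral - F (3/4) - - F (1/4)) {1/4..3/4}"
  proof (rule has_integral_eq[OF _ fundamental_theorem_of_calculus[OF _ has_vector_derivative_minus[OF D]]])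
    fix x :: real assume x: "x \<in> {1/4..3/4}"
    have "cos (2*pi*x - pi) \<ge> 0" using x by (intro cos_ge_zero) (auto simp: field_simps)
    then show "- cos (2*pi*x) = \<bar>cos (2*pi*x)\<bar>" by simp
  qed simp
  have c: "((\<lambda>x. \<bar>cos (2*pi*x)\<bar>) has_integral F 1 - F (3/4)) {3/4..1}"
  proof (rule has_integral_eq[OF _ fundamental_theorem_of_calculus[OF _ D]])
    fix x :: real assume x: "x \<in> {3/4..1}"
    have "cos (2*pi*x - 2*pi) \<ge> 0" using x by (intro cos_ge_zero) (auto simp: field_simps)
    then show "cos (2*pi*x) = \<bar>cos (2*pi*x)\<bar>" by (simp add: cos_diff)
  qed simp
  have s34: "sin (2*pi*(3/4)) = -1"
  proof -
    have "2*pi*(3/4) = 3/2*pi" by simp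
    then show ?thesis using sin_3over2_pi by simp
  qed
  have "((\<lambda>x. \<bar>cos (2*pi*x)\<bar>) has_integral (F (1/4) - F 0) + (- F (3/4) - - F (1/4))) {0..3/4}"
    by (rule has_integral_combine[OF _ _ a b]) auto
  from has_integral_combine[OF _ _ this c]
  have "((\<lambda>x. \<bar>cos (2*pi*x)\<bar>) has_integral
    ((F (1/4) - F 0) + (- F (3/4) - - F (1/4))) + (F 1 - F (3/4))) {0..1}" by simp
  moreover have "((F (1/4) - F 0) + (- F (3/4) - - F (1/4))) + (F 1 - F (3/4)) = 2/pi"
    unfolding F_def s34 by simp
  ultimately show ?thesis by simp
qed

text \<open>These are the means of |cos|^k over a period; the two-step recursion lets both parities
  of the exponent share one induction.\<close>

fun wallis_mean :: "nat \<Rightarrow> real" where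
  "wallis_mean 0 = 1"
| "wallis_mean (Suc 0) = 2 / pi"
| "wallis_mean (Suc (Suc k)) = (real k + 1) / (real k + 2) * wallis_mean k"

lemma wallis_mean_pos: "wallis_mean k > 0"
  by (induction k rule: wallis_mean.induct) (auto intro!: mult_pos_pos divide_pos_pos)

text \<open>The reduction step holds for every phase, so only exponent 1 has to look at the parity
  of \<open>n\<close>.\<close>

lemma has_integral_abs_cos_power:
  "((\<lambda>x. \<bar>cos (2*pi*x - real n * pi / 2)\<bar>^r) has_integral wallis_mean r) {0..1}"
proof (induction r rule: wallis_mean.induct)
  case 1
  show ?case using has_integral_const_real[of "1::real" 0 1] by simp
next
  case 2
  show ?case
    by (cases "even n")
       (simp_all add: abs_cos_sub_quarter_even abs_cos_sub_quarter_odd has_integral_abs_sin has_integral_abs_cos)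
next
  case (3 k)
  from has_integral_abs_cos_power_step[OF this] show ?case by simp
qed

section \<open>Wallis means as quotients of products of odd and even numbers\<close>

text \<open>Two factors are split off at once to match the recursion of \<open>wallis_mean\<close>;
  a general \<open>P\<close> covers the odd and the even product.\<close>

lemma prod_parity_Suc_Suc:
  fixes k :: nat
  shows "(\<Prod>i | i \<in> {1..Suc (Suc k)} \<and> P i. real i) =
    (\<Prod>i | i \<in> {1..k} \<and> P i. real i) * (if P (Suc k) then real (Suc k) else 1)
      * (if P (Suc (Suc k)) then real (Suc (Suc k)) else 1)"
proof -
  have "{i. i \<in> {1..Suc m} \<and> P i} =
      (if P (Suc m) then insert (Suc m) {i. i \<in> {1..m} \<and> P i} else {i. i \<in> {1..m} \<and> P i})" for m
    by (auto simp: le_Suc_eq)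
  then have "(\<Prod>i | i \<in> {1..Suc m} \<and> P i. real i) =
      (\<Prod>i | i \<in> {1..m} \<and> P i. real i) * (if P (Suc m) then real (Suc m) else 1)" for m
    by (simp add: mult.commute)
  then show ?thesis by presburger
qed

lemma wallis_mean_even:
  "even r \<Longrightarrow> wallis_mean r =
     (\<Prod>k | k \<in> {1..r} \<and> odd k. real k) / (\<Prod>k | k \<in> {1..r} \<and> even k. real k)"
proof (induction r rule: wallis_mean.induct)
  case (3 k)
  then show ?case unfolding prod_parity_Suc_Suc by (simp add: ac_simps)
qed simp_all

lemma wallis_mean_odd:
  "odd r \<Longrightarrow> wallis_mean r =
     (\<Prod>k | k \<in> {1..r} \<and> even k. real k) / (\<Prod>k | k \<in> {1..r} \<and> odd k. real k) * (2 / pi)"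
proof (induction r rule: wallis_mean.induct)
  case 2
  \<comment> \<open>For r = 1 the even product is empty and has value 1.\<close>
  have "{k. k \<in> {1..Suc 0} \<and> even k} = {}" "{k. k \<in> {1..Suc 0} \<and> odd k} = {1}"
    by (auto simp: le_Suc_eq)
  then show ?case by simp
next
  case (3 k)
  then show ?case unfolding prod_parity_Suc_Suc by (simp add: ac_simps)
qed simp_all

section \<open>Convergence of the rescaled integrals\<close>

text \<open>The power of \<open>M\<close> is k rather than the sharp k - 1, which avoids truncated
  subtraction; M >= 1 pays for it.\<close>

lemma abs_power_diff_le:
  fixes a b :: real
  assumes "\<bar>a\<bar> \<le> M" "\<bar>b\<bar> \<le> M" "M \<ge> 1"
  shows "\<bar>a^k - b^k\<bar> \<le> real k * M^k * \<bar>a - b\<bar>"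
proof (induction k)
  case (Suc k)
  have "a^Suc k - b^Suc k = a * (a^k - b^k) + (a - b) * b^k" by (simp add: algebra_simps)
  then have "\<bar>a^Suc k - b^Suc k\<bar> \<le> \<bar>a\<bar> * \<bar>a^k - b^k\<bar> + \<bar>a - b\<bar> * \<bar>b\<bar>^k"
    by (metis abs_mult abs_triangle_ineq power_abs)
  also have "\<dots> \<le> M * (real k * M^k * \<bar>a - b\<bar>) + \<bar>a - b\<bar> * M^Suc k"
  proof (intro add_mono mult_mono Suc order_refl)
    have "\<bar>b\<bar>^k \<le> M^k" using assms by (intro power_mono) auto
    also have "\<dots> \<le> M^Suc k" using assms(3) by (intro power_increasing) auto
    finally show "\<bar>b\<bar>^k \<le> M^Suc k" .
  qed (use assms in auto)
  finally show ?case by (simp add: algebra_simps)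
qed simp

text \<open>\<open>U + W\<close> is half the remainder, so \<open>U\<close> is uniformly close to
  \<open>- W\<close>. The absolute values absorb the sign, and \<open>abs_power_diff_le\<close>
  carries the estimate to r-th powers.\<close>

lemma integral_abs_rescaled_bernoulli_power_tendsto:
  "(\<lambda>n. integral {0..1} (\<lambda>x. \<bar>(2*pi)^n / 2 * poly (scaled_bernoulli_poly n) x\<bar>^r)) \<longlonglongrightarrow> wallis_mean r"
proof -
  obtain C where C: "\<And>n x. x \<in> {0..1} \<Longrightarrow> \<bar>bernoulli_remainder (Suc n) x\<bar> \<le> C * (pi/4)^n"
    by (rule bernoulli_remainder_geometric_bound) blast
  \<comment> \<open>This bounds |W| <= 1 as well as |U| <= |W| + |U + W|.\<close>
  define M where "M = 1 + C"
  have C0: "C \<ge> 0" using C[of 0 0] by simp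
  have pi4: "0 \<le> pi/4" "pi/4 < 1" using pi_less_4 by auto
  define U where "U n x = (2*pi)^n / 2 * poly (scaled_bernoulli_poly n) x" for n x
  define W where "W n x = cos (2*pi*x - real n * pi / 2)" for n x
  have bound: "\<bar>integral {0..1} (\<lambda>x. \<bar>U (Suc n) x\<bar>^r) - wallis_mean r\<bar> \<le> real r * M^r * (C * (pi/4)^n)" for n
  proof -
    have U: "((\<lambda>x. \<bar>U (Suc n) x\<bar>^r) has_integral integral {0..1} (\<lambda>x. \<bar>U (Suc n) x\<bar>^r)) {0..1}"
      unfolding U_def
      by (intro integrable_integral integrable_continuous_real continuous_intros)
    from has_integral_diff[OF this has_integral_abs_cos_power[of "Suc n" r, folded W_def]]
    have d: "((\<lambda>x. \<bar>U (Suc n) x\<bar>^r - \<bar>W (Suc n) x\<bar>^r) has_integral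
      integral {0..1} (\<lambda>x. \<bar>U (Suc n) x\<bar>^r) - wallis_mean r) {0..1}" .
    have "\<bar>\<bar>U (Suc n) x\<bar>^r - \<bar>W (Suc n) x\<bar>^r\<bar> \<le> real r * M^r * (C * (pi/4)^n)" if x: "x \<in> {0..1}" for x
    proof -
      have UW: "U (Suc n) x + W (Suc n) x = bernoulli_remainder (Suc n) x / 2"
        by (simp add: U_def W_def bernoulli_remainder_def field_simps)
      have le: "\<bar>U (Suc n) x + W (Suc n) x\<bar> \<le> C * (pi/4)^n"
        unfolding UW using C[OF x, of n] by simp
      have "(pi/4)^n \<le> 1" using pi4 by (intro power_le_one) auto
      then have le1: "C * (pi/4)^n \<le> C" using C0 by (simp add: mult_left_le)
      have w: "\<bar>W (Suc n) x\<bar> \<le> 1" unfolding W_def by (rule abs_cos_le_one)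
      have "\<bar>\<bar>U (Suc n) x\<bar>^r - \<bar>W (Suc n) x\<bar>^r\<bar> \<le> real r * M^r * \<bar>\<bar>U (Suc n) x\<bar> - \<bar>W (Suc n) x\<bar>\<bar>"
        by (rule abs_power_diff_le) (use w le le1 C0 in \<open>auto simp: M_def\<close>)
      also have "\<dots> \<le> real r * M^r * (C * (pi/4)^n)"
        by (rule mult_left_mono) (use le C0 in \<open>auto simp: M_def\<close>)
      finally show ?thesis .
    qed
    moreover have "0 \<le> real r * M^r * (C * (pi/4)^n)" using C0 pi4 by (simp add: M_def)
    ultimately show ?thesis
      using has_integral_bound_real[OF _ finite.emptyI d, of "real r * M^r * (C * (pi/4)^n)"] by simp
  qed
  have "(\<lambda>n. integral {0..1} (\<lambda>x. \<bar>U (Suc n) x\<bar>^r) - wallis_mean r) \<longlonglongrightarrow> 0"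
  proof (rule Lim_null_comparison)
    show "\<forall>\<^sub>F n in sequentially. norm (integral {0..1} (\<lambda>x. \<bar>U (Suc n) x\<bar>^r) - wallis_mean r)
        \<le> real r * M^r * (C * (pi/4)^n)" using bound by simp
    have "(\<lambda>n. (pi/4)^n) \<longlonglongrightarrow> 0" using pi4 by (intro LIMSEQ_realpow_zero) auto
    then show "(\<lambda>n. real r * M^r * (C * (pi/4)^n)) \<longlonglongrightarrow> 0" by (intro tendsto_mult_right_zero)
  qed
  then have "(\<lambda>n. integral {0..1} (\<lambda>x. \<bar>U (Suc n) x\<bar>^r)) \<longlonglongrightarrow> wallis_mean r"
    by (rule LIM_zero_cancel)
  \<comment> \<open>The remainder bound starts at index 1, so the limit was found for the shifted
    sequence.\<close>
  then show ?thesis unfolding U_def by (rule LIMSEQ_imp_Suc)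
qed

section \<open>From integrals to norms\<close>

lemma poly_Lnorm_smult:
  assumes "c \<ge> 0" "r > 0"
  shows "poly_Lnorm r (smult c p) = c * poly_Lnorm r p"
proof -
  have "integral {0..1} (\<lambda>x. \<bar>poly (smult c p) x\<bar> powr r) = c powr r * integral {0..1} (\<lambda>x. \<bar>poly p x\<bar> powr r)"
    using assms by (simp add: abs_mult powr_mult)
  moreover have "continuous_on {0..1} (\<lambda>x. \<bar>poly p x\<bar> powr r)"
    by (rule continuous_on_powr') (use assms in \<open>auto intro!: continuous_intros\<close>)
  then have "integral {0..1} (\<lambda>x. \<bar>poly p x\<bar> powr r) \<ge> 0"
    by (intro integral_nonneg integrable_continuous_real) auto
  ultimately show ?thesis using assms by (simp add: poly_Lnorm_def powr_mult powr_powr)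
qed

text \<open>Positivity of \<open>r\<close> matters at the zeros of \<open>p\<close>:
  \<open>0 powr 0\<close> is 0 whereas \<open>0 ^ 0\<close> is 1.\<close>

lemma poly_Lnorm_of_nat:
  assumes "r > 0"
  shows "poly_Lnorm (real r) p = integral {0..1} (\<lambda>x. \<bar>poly p x\<bar>^r) powr (1 / real r)"
  using assms by (simp add: poly_Lnorm_def powr_realpow')

text \<open>Homogeneity of the norm takes out 2 / (2 pi)^n exactly. The other factor converges to a
  nonzero constant, and for such a limit convergence implies asymptotic equivalence.\<close>

lemma poly_Lnorm_scaled_bernoulli_asymp:
  assumes "r > 0"
  shows "(\<lambda>n. poly_Lnorm (real r) (scaled_bernoulli_poly n)) \<sim>[sequentially]
         (\<lambda>n. 2 / (2 * pi) ^ n * wallis_mean r powr (1 / real r))"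
proof -
  have eq: "poly_Lnorm (real r) (scaled_bernoulli_poly n) = 2 / (2*pi)^n *
     integral {0..1} (\<lambda>x. \<bar>(2*pi)^n / 2 * poly (scaled_bernoulli_poly n) x\<bar>^r) powr (1 / real r)" for n
  proof -
    have "smult (2 / (2*pi)^n) (smult ((2*pi)^n / 2) (scaled_bernoulli_poly n)) = scaled_bernoulli_poly n"
      by simp
    then show ?thesis
      using assms poly_Lnorm_smult[of "2 / (2*pi)^n" "real r" "smult ((2*pi)^n / 2) (scaled_bernoulli_poly n)"]
      by (simp add: poly_Lnorm_of_nat)
  qed
  have "(\<lambda>n. integral {0..1} (\<lambda>x. \<bar>(2*pi)^n / 2 * poly (scaled_bernoulli_poly n) x\<bar>^r) powr (1 / real r))
     \<longlonglongrightarrow> wallis_mean r powr (1 / real r)"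
    using wallis_mean_pos[of r]
    by (intro tendsto_powr integral_abs_rescaled_bernoulli_power_tendsto tendsto_const) auto
  then show ?thesis unfolding eq
    using wallis_mean_pos[of r]
    by (intro asymp_equiv_mult asymp_equiv_refl tendsto_imp_asymp_equiv_const) auto
qed

theorem mainTheorem10:
  fixes r :: nat
  assumes "r \<ge> 2"
  shows "(even r \<longrightarrow>
            (\<lambda>n. poly_Lnorm (real r) (scaled_bernoulli_poly n)) \<sim>[sequentially]
            (\<lambda>n. 2 / (2 * pi) ^ n *
               ((\<Prod>k | k \<in> {1..r} \<and> odd k. real k) / (\<Prod>k | k \<in> {1..r} \<and> even k. real k))
                 powr (1 / real r)))
       \<and> (odd r \<longrightarrow>
            (\<lambda>n. poly_Lnorm (real r) (scaled_bernoulli_poly n)) \<sim>[sequentially]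
            (\<lambda>n. 2 / (2 * pi) ^ n *
               ((\<Prod>k | k \<in> {1..r} \<and> even k. real k) / (\<Prod>k | k \<in> {1..r} \<and> odd k. real k)
                 * (2 / pi)) powr (1 / real r)))"
proof -
  have "r > 0" using assms by simp
  note asymp = poly_Lnorm_scaled_bernoulli_asymp[OF this]
  show ?thesis
  proof (cases "even r")
    case True
    with asymp show ?thesis unfolding wallis_mean_even[OF True] by blast
  next
    case False
    with asymp show ?thesis unfolding wallis_mean_odd[OF False] by blast
  qed
qed

end
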